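(* Let $L$ be a homogeneous geometric lattice of rank $n$ and let $\overline{L}=L\setminus\{\hat0,\hat1\}$, identified with its order complex. Then $$h^{n-3}(\overline{L})\ \ge\ \frac{f_{n-2}(\overline{L})}{f_{n-3}(\overline{L})\sum_{j=1}^{n-1}j!}.$$
   Context: A geometric lattice is a finite ranked lattice $L$ (minimum $\hat0$, maximum $\hat1$, rank function with $\mathrm{rk}(\hat0)=0$ increasing by one along covers) satisfying $\mathrm{rk}(x)+\mathrm{rk}(y)\ge\mathrm{rk}(x\vee y)+\mathrm{rk}(x\wedge y)$ and in which every element is a join of atoms; its rank is $\mathrm{rk}(\hat1)$. The order complex of a poset has the poset's elements as vertices and its chains $a_0<\dots<a_k$ as simplices. $L$ is homogeneous if $\mathrm{Aut}(L)$ acts transitively on the $(n-2)$-dimensional simplices of $\overline{L}$. $f_i$ denotes the number of $i$-dimensional simplices. Cochains have $\mathbb{Z}_2$ coefficients; $\|\phi\|$ is the support size, $\|\phi\|_{csy}=\min_\psi\|\phi+d_{k-1}\psi\|$, and $h^k(X)=\min\{\|d_k\phi\|/\|\phi\|_{csy}:\phi\in C^k(X)\setminus B^k(X)\}$. *)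

theory Defs
  imports Complex_Main "HOL-Library.Z2"
begin

section \<open>Geometric lattices\<close>

definition covers :: "'a::order \<Rightarrow> 'a \<Rightarrow> bool" where
  "covers x y \<longleftrightarrow> x < y \<and> \<not> (\<exists>z. x < z \<and> z < y)"

definition atoms :: "'a::order_bot set" where
  "atoms = {a. covers bot a}"

text \<open>
  A finite nonempty lattice is complete in exactly one way, so the sort below is just that of
  finite lattices. The join of the empty set of atoms is \<^term>\<open>bot\<close>. The rank
  function is determined by \<open>rk_bot\<close> and \<open>rk_covers\<close>.
\<close>

locale geometric_lattice =
  fixes rk :: "'a::{finite,complete_lattice} \<Rightarrow> nat"
  assumes rk_bot: "rk bot = 0"
    and rk_covers: "\<And>x y. covers x y \<Longrightarrow> rk y = rk x + 1"
    and rk_submodular: "\<And>x y. rk x + rk y \<ge> rk (sup x y) + rk (inf x y)"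
    and join_of_atoms: "\<And>x::'a. \<exists>A\<subseteq>atoms. x = Sup A"

definition proper_part :: "'a::complete_lattice set" where
  "proper_part = UNIV - {bot, top}"

definition automorphisms :: "('a::order \<Rightarrow> 'a) set" where
  "automorphisms = {g. bij g \<and> (\<forall>x y. g x \<le> g y \<longleftrightarrow> x \<le> y)}"


section \<open>Simplicial complexes and \<open>\<int>\<^sub>2\<close>-cochains\<close>

text \<open>
  A simplicial complex is given by its set of simplices, the empty simplex (of dimension
  \<open>-1\<close>) included. Dimensions are integers, and cochains are augmented:
  \<open>C\<^sup>-\<^sup>1\<close> is one copy of \<open>\<int>\<^sub>2\<close>, carried by the empty
  simplex, and \<open>B\<^sup>0\<close> consists of the constant functions on the vertices.
\<close>

definition order_complex :: "'a::order set \<Rightarrow> 'a set set" where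
  "order_complex P = {\<sigma>. \<sigma> \<subseteq> P \<and> finite \<sigma> \<and> Complete_Partial_Order.chain (\<le>) \<sigma>}"

definition simplices :: "'v set set \<Rightarrow> int \<Rightarrow> 'v set set" where
  "simplices X k = {\<sigma> \<in> X. finite \<sigma> \<and> int (card \<sigma>) = k + 1}"

definition face_number :: "'v set set \<Rightarrow> int \<Rightarrow> nat" where
  "face_number X k = card (simplices X k)"

text \<open>Cochains are extended by 0 outside the \<open>k\<close>-simplices.\<close>

definition cochains :: "'v set set \<Rightarrow> int \<Rightarrow> ('v set \<Rightarrow> bit) set" where
  "cochains X k = {\<phi>. \<forall>\<sigma>. \<sigma> \<notin> simplices X k \<longrightarrow> \<phi> \<sigma> = 0}"

definition coboundary :: "'v set set \<Rightarrow> int \<Rightarrow> ('v set \<Rightarrow> bit) \<Rightarrow> 'v set \<Rightarrow> bit" where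
  "coboundary X k \<phi> = (\<lambda>\<tau>. if \<tau> \<in> simplices X (k + 1) then \<Sum>v\<in>\<tau>. \<phi> (\<tau> - {v}) else 0)"

definition coboundaries :: "'v set set \<Rightarrow> int \<Rightarrow> ('v set \<Rightarrow> bit) set" where
  "coboundaries X k = coboundary X (k - 1) ` cochains X (k - 1)"

definition supp_norm :: "('v set \<Rightarrow> bit) \<Rightarrow> nat" where
  "supp_norm \<phi> = card {\<sigma>. \<phi> \<sigma> \<noteq> 0}"

definition csy_norm :: "'v set set \<Rightarrow> int \<Rightarrow> ('v set \<Rightarrow> bit) \<Rightarrow> nat" where
  "csy_norm X k \<phi> =
    Min {supp_norm (\<lambda>\<sigma>. \<phi> \<sigma> + coboundary X (k - 1) \<psi> \<sigma>) | \<psi>. \<psi> \<in> cochains X (k - 1)}"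

definition cheeger :: "'v set set \<Rightarrow> int \<Rightarrow> real" where
  "cheeger X k =
    Min {real (supp_norm (coboundary X k \<phi>)) / real (csy_norm X k \<phi>) | \<phi>.
      \<phi> \<in> cochains X k - coboundaries X k}"


section \<open>Homogeneous lattices\<close>

definition homogeneous :: "('a::{finite,complete_lattice} \<Rightarrow> nat) \<Rightarrow> bool" where
  "homogeneous rk \<longleftrightarrow>
    (let F = simplices (order_complex (proper_part :: 'a set)) (int (rk top) - 2)
     in \<forall>\<sigma>\<in>F. \<forall>\<tau>\<in>F. \<exists>g\<in>automorphisms. g ` \<sigma> = \<tau>)"

end

theory Submission
  imports Defs
begin

text \<open>
  Choose an atom \<open>a\<close> and for each proper \<open>x\<close> an atom \<open>p x \<le> x\<close>, and write
  \<open>sd(u\<^sub>0, \<dots>, u\<^sub>j)\<close> for the sum of the \<open>(j + 1)!\<close> chains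
  \<open>u\<^sub>\<pi>\<^sub>0 < u\<^sub>\<pi>\<^sub>0 \<or> u\<^sub>\<pi>\<^sub>1 < \<dots>\<close>, degenerate ones counting as zero. Then
  \<open>T(x\<^sub>0 < \<dots> < x\<^sub>k) = \<Sum>\<^sub>j sd(p x\<^sub>0, \<dots>, p x\<^sub>j) * (x\<^sub>j < \<dots> < x\<^sub>k) + sd(a, p x\<^sub>0, \<dots>, p x\<^sub>k)\<close>
  satisfies \<open>\<partial>T + T\<partial> = id\<close>, and it stays inside the proper part for \<open>k \<le> n - 3\<close>, because a join
  of \<open>m\<close> atoms has rank at most \<open>m\<close>. Dually \<open>\<phi> + d(T\<^sup>*\<phi>) = T\<^sup>*(d\<phi>)\<close>, so the cosystolic norm of \<open>\<phi>\<close>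
  is at most the number of pairs of an \<open>(n - 3)\<close>-simplex \<open>\<sigma>\<close> and a simplex \<open>\<tau>\<close> of \<open>T\<sigma>\<close> lying in the
  support of \<open>d\<phi>\<close>. The same holds for every translate of \<open>\<phi>\<close> by an automorphism; since
  \<open>T\<sigma>\<close> has at most \<open>\<Sum>\<^sub>j j!\<close> simplices, \<open>j = 1, \<dots>, n - 1\<close>, averaging over the automorphism
  group gives the bound.
\<close>


section \<open>Faces of lists\<close>

text \<open>This simp rule turns sums of bits into \<^const>\<open>of_bool\<close> expressions.\<close>

declare add_bit_eq_xor [simp del]

text \<open>Signs are absent because coefficients are bits. The list \<open>[x]\<close> has the face
  \<open>[]\<close> while \<open>[]\<close> has none, which matches the augmented complex.\<close>

fun faces :: "'v list \<Rightarrow> 'v list list" where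
  "faces [] = []"
| "faces (x # xs) = xs # map ((#) x) (faces xs)"

lemma length_faces [simp]: "length (faces xs) = length xs"
  by (induction xs) auto

lemma length_face: "ys \<in> set (faces xs) \<Longrightarrow> length xs = Suc (length ys)"
  by (induction xs arbitrary: ys) auto

lemma set_face: "ys \<in> set (faces xs) \<Longrightarrow> set ys \<subseteq> set xs"
  by (induction xs arbitrary: ys) fastforce+

lemma sorted_wrt_face: "ys \<in> set (faces xs) \<Longrightarrow> sorted_wrt R xs \<Longrightarrow> sorted_wrt R ys"
  by (induction xs arbitrary: ys) (auto, blast dest: set_face[THEN subsetD])

lemma faces_snoc: "faces (xs @ [x]) = map (\<lambda>ys. ys @ [x]) (faces xs) @ [xs]"
  by (induction xs) auto

lemma bit_add_self: "b + b = (0::bit)"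
  by (cases b) auto

lemma sum_list_faces_Cons:
  "(\<Sum>ys\<leftarrow>faces (x # xs). f ys) = f xs + (\<Sum>ys\<leftarrow>faces xs. f (x # ys))"
  by (simp add: o_def)

lemma sum_list_map_concat: "(\<Sum>x\<leftarrow>concat xss. f x) = (\<Sum>xs\<leftarrow>xss. \<Sum>x\<leftarrow>xs. f x)"
  for f :: "'b \<Rightarrow> 'c::comm_monoid_add"
  by (induction xss) auto

lemma sum_list_swap: "(\<Sum>x\<leftarrow>xs. \<Sum>y\<leftarrow>ys. f x y) = (\<Sum>y\<leftarrow>ys. \<Sum>x\<leftarrow>xs. f x y)"
  for f :: "'b \<Rightarrow> 'c \<Rightarrow> 'd::comm_monoid_add"
  by (induction xs) (auto simp: sum_list_addf)

lemma sum_list_eqI: "(\<And>x. x \<in> set xs \<Longrightarrow> f x = g x) \<Longrightarrow> (\<Sum>x\<leftarrow>xs. f x) = (\<Sum>x\<leftarrow>xs. g x)"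
  by (metis map_cong)

text \<open>Each list with two entries removed arises in two orders and cancels in characteristic 2;
  in the induction it is the sum over \<open>faces xs\<close> that occurs twice.\<close>

lemma sum_faces_faces: "(\<Sum>ys\<leftarrow>faces xs. \<Sum>zs\<leftarrow>faces ys. f zs) = (0::bit)"
proof (induction xs arbitrary: f)
  case (Cons x xs)
  have "(\<Sum>ys\<leftarrow>faces (x # xs). \<Sum>zs\<leftarrow>faces ys. f zs) =
      (\<Sum>zs\<leftarrow>faces xs. f zs) + ((\<Sum>ys\<leftarrow>faces xs. f ys) + (\<Sum>ys\<leftarrow>faces xs. \<Sum>zs\<leftarrow>faces ys. f (x # zs)))"
    by (simp only: sum_list_faces_Cons sum_list_addf)
  then show ?case
    by (simp only: Cons.IH add_0_right bit_add_self)
qed simp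

lemma sum_faces_set:
  fixes g :: "'v set \<Rightarrow> bit"
  assumes "distinct xs"
  shows "(\<Sum>ys\<leftarrow>faces xs. g (set ys)) = (\<Sum>v\<in>set xs. g (set xs - {v}))"
  using assms
proof (induction xs arbitrary: g)
  case (Cons x xs)
  have "(\<Sum>v\<in>set xs. g (insert x (set xs) - {v})) = (\<Sum>v\<in>set xs. g (insert x (set xs - {v})))"
    using Cons.prems by (intro sum.cong) (auto simp: insert_Diff_if)
  with Cons.prems Cons.IH[of "\<lambda>S. g (insert x S)"] show ?case
    by (simp add: o_def)
qed simp

section \<open>Degenerate lists\<close>

text \<open>The value 0 amounts to working with normalized chains: joins in a flag may coincide, so
  lists with repetitions do occur.\<close>

definition list_cochain :: "('v set \<Rightarrow> bit) \<Rightarrow> 'v list \<Rightarrow> bit" where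
  "list_cochain \<phi> xs = (if distinct xs then \<phi> (set xs) else 0)"

text \<open>A face can become distinct only by losing one of two copies of a single repeated entry,
  so no element disappears.\<close>

lemma set_distinct_face:
  assumes "\<not> distinct xs" "ys \<in> set (faces xs)" "distinct ys"
  shows "set ys = set xs"
  using assms
proof (induction xs arbitrary: ys)
  case (Cons x xs)
  show ?case
  proof (cases "distinct xs")
    case True
    with Cons.prems have x: "x \<in> set xs" by simp
    consider "ys = xs" | zs where "zs \<in> set (faces xs)" "ys = x # zs"
      using Cons.prems(2) by auto
    then show ?thesis
    proof cases
      case 2
      have "set zs = set xs - {x}"
        using True x 2 Cons.prems(3) set_face[of zs xs] length_face[of zs xs]
        by (intro card_subset_eq) (auto simp: distinct_card)
      with 2 x show ?thesis by auto
    qed (use x in auto)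
  next
    case False
    with Cons show ?thesis by auto
  qed
qed simp

lemma distinct_face: "ys \<in> set (faces xs) \<Longrightarrow> distinct xs \<Longrightarrow> distinct ys"
  by (induction xs arbitrary: ys) (auto dest: set_face[THEN subsetD])

lemma list_cochain_Cons:
  "list_cochain \<phi> (x # xs) =
    (if x \<in> set xs then 0 else list_cochain (\<lambda>S. \<phi> (insert x S)) xs)"
  by (simp add: list_cochain_def)

text \<open>Distinct faces exist only if a single entry is doubled; they are then the two deletions
  of a copy, which have the same set and cancel.\<close>

lemma sum_faces_list_cochain_degenerate:
  assumes "\<not> distinct xs"
  shows "(\<Sum>ys\<leftarrow>faces xs. list_cochain \<phi> ys) = 0"
  using assms
proof (induction xs arbitrary: \<phi>)
  case (Cons x xs)
  consider "x \<notin> set xs" "\<not> distinct xs" | "x \<in> set xs" "distinct xs"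
    | "x \<in> set xs" "\<not> distinct xs"
    using Cons.prems by auto
  then show ?case
  proof cases
    case 1
    have "(\<Sum>ys\<leftarrow>faces xs. list_cochain \<phi> (x # ys)) =
        (\<Sum>ys\<leftarrow>faces xs. list_cochain (\<lambda>S. \<phi> (insert x S)) ys)"
      using 1 set_face by (intro sum_list_eqI) (fastforce simp: list_cochain_Cons)
    then show ?thesis
      unfolding sum_list_faces_Cons using 1 Cons.IH by (simp add: list_cochain_def)
  next
    case 2
    \<comment> \<open>\<open>?g\<close> turns distinctness of \<open>x # ys\<close> into a condition
      on the set of \<open>ys\<close>, so that only the deletion of the copy of \<open>x\<close>
      inside \<open>xs\<close> survives.\<close>
    let ?g = "\<lambda>S. if x \<in> S then 0 else \<phi> (insert x S)"
    have "(\<Sum>ys\<leftarrow>faces xs. list_cochain \<phi> (x # ys)) = (\<Sum>ys\<leftarrow>faces xs. ?g (set ys))"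
      using 2 distinct_face by (intro sum_list_eqI) (auto simp: list_cochain_def)
    also have "\<dots> = (\<Sum>v\<in>set xs. ?g (set xs - {v}))"
      using 2 by (intro sum_faces_set)
    also have "\<dots> = (\<Sum>v\<in>set xs. if v = x then \<phi> (set xs) else 0)"
      using 2 by (intro sum.cong) (auto simp: insert_absorb)
    also have "\<dots> = \<phi> (set xs)"
      using 2 by simp
    finally show ?thesis
      unfolding sum_list_faces_Cons using 2 by (simp add: list_cochain_def bit_add_self)
  next
    case 3
    have "(\<Sum>ys\<leftarrow>faces xs. list_cochain \<phi> (x # ys)) = (\<Sum>ys\<leftarrow>faces xs. 0)"
      using 3 set_distinct_face[of xs] by (intro sum_list_eqI) (auto simp: list_cochain_def)
    then show ?thesis
      unfolding sum_list_faces_Cons using 3 by (simp add: list_cochain_def)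
  qed
qed simp

lemma sum_faces_list_cochain:
  "(\<Sum>ys\<leftarrow>faces xs. list_cochain \<phi> ys) =
    (if distinct xs then \<Sum>v\<in>set xs. \<phi> (set xs - {v}) else 0)"
proof (cases "distinct xs")
  case True
  have "(\<Sum>ys\<leftarrow>faces xs. list_cochain \<phi> ys) = (\<Sum>ys\<leftarrow>faces xs. \<phi> (set ys))"
    using distinct_face[OF _ True] by (intro sum_list_eqI) (simp add: list_cochain_def)
  with True sum_faces_set[OF True, of \<phi>] show ?thesis by simp
qed (simp add: sum_faces_list_cochain_degenerate)


section \<open>The contracting homotopy\<close>

text \<open>
  The barycentric subdivision of the simplex on \<open>us\<close>, as the cone over the subdivided boundary
  with apex \<open>Sup us\<close>; each flag is followed by \<open>ys\<close>.
\<close>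

function flags :: "'a::complete_lattice list \<Rightarrow> 'a list \<Rightarrow> 'a list list" where
  "flags [] ys = [ys]"
| "flags (u # us) ys =
    concat (map (\<lambda>vs. flags vs (Sup (set (u # us)) # ys)) (faces (u # us)))"
  by pat_completeness auto
termination
  by (relation "measure (length \<circ> fst)") (auto dest: length_face)

text \<open>The second equation rewrites its own right-hand side forever.\<close>

declare flags.simps(2) [simp del]

text \<open>Subdivision is a chain map because it is a cone over the subdivided boundary: removing
  the apex gives that boundary back, and the boundary of the boundary vanishes. The tail
  \<open>ys\<close> contributes as in the boundary of a join.\<close>

lemma sum_flags_faces:
  fixes f :: "'a::complete_lattice list \<Rightarrow> bit"
  shows "(\<Sum>t\<leftarrow>flags us ys. \<Sum>s\<leftarrow>faces t. f s) =
    (\<Sum>vs\<leftarrow>faces us. \<Sum>s\<leftarrow>flags vs ys. f s) + (\<Sum>zs\<leftarrow>faces ys. \<Sum>s\<leftarrow>flags us zs. f s)"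
proof (induction us ys rule: flags.induct)
  case (1 ys)
  then show ?case by simp
next
  case (2 u us ys)
  let ?us = "u # us" and ?s = "Sup (set (u # us))"
  have "(\<Sum>t\<leftarrow>flags ?us ys. \<Sum>s\<leftarrow>faces t. f s) =
      (\<Sum>vs\<leftarrow>faces ?us. \<Sum>t\<leftarrow>flags vs (?s # ys). \<Sum>s\<leftarrow>faces t. f s)"
    by (simp only: flags.simps sum_list_map_concat map_map o_def)
  also have "\<dots> = (\<Sum>vs\<leftarrow>faces ?us. (\<Sum>ws\<leftarrow>faces vs. \<Sum>s\<leftarrow>flags ws (?s # ys). f s) +
        (\<Sum>zs\<leftarrow>faces (?s # ys). \<Sum>s\<leftarrow>flags vs zs. f s))"
    by (intro sum_list_eqI 2)
  also have "\<dots> = (\<Sum>vs\<leftarrow>faces ?us. \<Sum>zs\<leftarrow>faces (?s # ys). \<Sum>s\<leftarrow>flags vs zs. f s)"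
    by (simp only: sum_list_addf sum_faces_faces add_0_left)
  also have "\<dots> = (\<Sum>vs\<leftarrow>faces ?us. \<Sum>s\<leftarrow>flags vs ys. f s) +
      (\<Sum>vs\<leftarrow>faces ?us. \<Sum>zs\<leftarrow>faces ys. \<Sum>s\<leftarrow>flags vs (?s # zs). f s)"
    by (simp only: sum_list_faces_Cons[of _ ?s ys] sum_list_addf)
  also have "(\<Sum>vs\<leftarrow>faces ?us. \<Sum>zs\<leftarrow>faces ys. \<Sum>s\<leftarrow>flags vs (?s # zs). f s) =
      (\<Sum>zs\<leftarrow>faces ys. \<Sum>s\<leftarrow>flags ?us zs. f s)"
    by (subst sum_list_swap) (simp only: flags.simps sum_list_map_concat map_map o_def)
  finally show ?case .
qed

text \<open>A flag records the order in which the entries of \<open>us\<close> are removed; flags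
  that coincide as lists are counted separately.\<close>

lemma length_flags: "length (flags us ys) = fact (length us)"
proof (induction us ys rule: flags.induct)
  case (2 u us ys)
  have "length (flags (u # us) ys) =
      (\<Sum>vs\<leftarrow>faces (u # us). length (flags vs (Sup (set (u # us)) # ys)))"
    by (simp only: flags.simps length_concat map_map o_def)
  also have "\<dots> = (\<Sum>vs\<leftarrow>faces (u # us). fact (length us))"
  proof (rule sum_list_eqI)
    fix vs assume vs: "vs \<in> set (faces (u # us))"
    show "length (flags vs (Sup (set (u # us)) # ys)) = fact (length us)"
      using 2[OF vs] length_face[OF vs]
      by (simp only: list.size add_Suc_right add_0_right nat.inject)
  qed
  also have "\<dots> = fact (length (u # us))"
    by (simp add: sum_list_triv o_def algebra_simps)
  finally show ?case .
qed simp

lemma flags_sorted: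
  assumes "t \<in> set (flags us ys)" "sorted_wrt (\<le>) ys" "\<And>y. y \<in> set ys \<Longrightarrow> Sup (set us) \<le> y"
  shows "sorted_wrt (\<le>) t"
  using assms
proof (induction us ys rule: flags.induct)
  case (2 u us ys)
  from 2(2) obtain vs where vs: "vs \<in> set (faces (u # us))"
    and t: "t \<in> set (flags vs (Sup (set (u # us)) # ys))"
    by (auto simp: flags.simps(2) simp del: faces.simps)
  have le: "Sup (set vs) \<le> Sup (set (u # us))"
    using set_face[OF vs] by (rule Sup_subset_mono)
  show ?case
  proof (rule 2(1)[OF vs t])
    show "sorted_wrt (\<le>) (Sup (set (u # us)) # ys)"
      using 2(3,4) by simp
    show "Sup (set vs) \<le> y" if "y \<in> set (Sup (set (u # us)) # ys)" for y
      using that le 2(4) by (metis order_trans set_ConsD)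
  qed
qed simp

lemma flags_length:
  "t \<in> set (flags us ys) \<Longrightarrow> length t = length us + length ys"
proof (induction us ys rule: flags.induct)
  case (2 u us ys)
  then obtain vs where vs: "vs \<in> set (faces (u # us))"
    and t: "t \<in> set (flags vs (Sup (set (u # us)) # ys))"
    by (auto simp: flags.simps(2) simp del: faces.simps)
  show ?case using 2(1)[OF vs t] length_face[OF vs] by simp
qed simp

text \<open>The bound on \<open>length vs\<close> is there because joins of atoms are only known to
  be proper when few atoms are involved.\<close>

lemma flags_subset:
  assumes "t \<in> set (flags us ys)"
    and "\<And>vs. vs \<noteq> [] \<Longrightarrow> set vs \<subseteq> set us \<Longrightarrow> length vs \<le> length us \<Longrightarrow> Sup (set vs) \<in> P"
    and "set ys \<subseteq> P"
  shows "set t \<subseteq> P"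
  using assms
proof (induction us ys rule: flags.induct)
  case (2 u us ys)
  from 2(2) obtain vs where vs: "vs \<in> set (faces (u # us))"
    and t: "t \<in> set (flags vs (Sup (set (u # us)) # ys))"
    by (auto simp: flags.simps(2) simp del: faces.simps)
  have "Sup (set (u # us)) \<in> P" by (rule 2(3)) auto
  moreover have "Sup (set ws) \<in> P" if "ws \<noteq> []" "set ws \<subseteq> set vs" "length ws \<le> length vs" for ws
    using 2(3)[of ws] that set_face[OF vs] length_face[OF vs] by auto
  ultimately show ?case
    using 2(4) by (intro 2(1)[OF vs t]) auto
qed simp

text \<open>
  \<open>filling a p [] xs\<close> lists the terms of \<open>T xs\<close>; \<open>us\<close> holds the atoms \<open>p x\<close> of the elements
  already passed.
\<close>

fun filling :: "'a::complete_lattice \<Rightarrow> ('a \<Rightarrow> 'a) \<Rightarrow> 'a list \<Rightarrow> 'a list \<Rightarrow> 'a list list" where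
  "filling a p us [] = flags (a # us) []"
| "filling a p us (x # xs) = flags (us @ [p x]) (x # xs) @ filling a p (us @ [p x]) xs"

text \<open>For \<open>us = []\<close> the first sum is empty and the last is \<open>f xs\<close>,
  which leaves \<open>\<partial>T + T\<partial> = id\<close>. General \<open>us\<close> is needed
  since each step of the recursion moves one more atom there.\<close>

lemma sum_filling_faces:
  fixes f :: "'a::complete_lattice list \<Rightarrow> bit"
  shows "(\<Sum>t\<leftarrow>filling a p us xs. \<Sum>s\<leftarrow>faces t. f s) =
    (\<Sum>vs\<leftarrow>faces us. \<Sum>s\<leftarrow>filling a p vs xs. f s) +
    (\<Sum>ys\<leftarrow>faces xs. \<Sum>s\<leftarrow>filling a p us ys. f s) + (\<Sum>s\<leftarrow>flags us xs. f s)"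
proof (induction xs arbitrary: us)
  case Nil
  show ?case
    by (simp only: filling.simps sum_flags_faces faces.simps list.map sum_list.Nil sum_list.Cons
        add_0_right add_0_left map_map o_def ac_simps)
next
  case (Cons x xs)
  let ?us = "us @ [p x]"
  let ?D = "\<lambda>us xs. \<Sum>s\<leftarrow>flags us xs. f s" and ?H = "\<lambda>us xs. \<Sum>s\<leftarrow>filling a p us xs. f s"
  have snoc: "(\<Sum>vs\<leftarrow>faces ?us. g vs) = (\<Sum>vs\<leftarrow>faces us. g (vs @ [p x])) + g us"
    for g :: "'a list \<Rightarrow> bit"
    by (simp add: faces_snoc o_def)
  have H: "?H vs (x # ys) = ?D (vs @ [p x]) (x # ys) + ?H (vs @ [p x]) ys" for vs ys
    by simp
  have "(\<Sum>t\<leftarrow>filling a p us (x # xs). \<Sum>s\<leftarrow>faces t. f s) =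
      (\<Sum>vs\<leftarrow>faces ?us. ?D vs (x # xs)) + (\<Sum>zs\<leftarrow>faces (x # xs). ?D ?us zs) +
      ((\<Sum>vs\<leftarrow>faces ?us. ?H vs xs) + (\<Sum>ys\<leftarrow>faces xs. ?H ?us ys) + ?D ?us xs)"
    by (simp only: filling.simps map_append sum_list_append sum_flags_faces Cons)
  \<comment> \<open>The blocks telescope: \<open>?D ?us xs\<close> comes once from deleting
    \<open>x\<close> in the first block and once from the induction hypothesis.\<close>
  also have "\<dots> = (\<Sum>vs\<leftarrow>faces us. ?H vs (x # xs)) + (?H us xs + (\<Sum>ys\<leftarrow>faces xs. ?H us (x # ys))) +
      ?D us (x # xs) + (?D ?us xs + ?D ?us xs)"
    by (simp only: H snoc sum_list_faces_Cons sum_list_addf ac_simps)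
  finally show ?case
    by (simp only: sum_list_faces_Cons bit_add_self add_0_right)
qed

text \<open>Each block subdivides a simplex with one more vertex than the block before. With
  \<open>us = []\<close> and \<open>n - 2\<close> elements this is the sum in the bound.\<close>

lemma length_filling:
  "length (filling a p us xs) = (\<Sum>j=Suc (length us)..Suc (length us + length xs). fact j)"
proof (induction xs arbitrary: us)
  case (Cons x xs)
  have "(\<Sum>j=Suc (length us)..Suc (length us + length (x # xs)). fact j) =
      fact (Suc (length us)) +
      (\<Sum>j=Suc (Suc (length us))..Suc (Suc (length us) + length xs). fact j :: nat)"
    by (subst sum.atLeast_Suc_atMost) (auto simp del: fact_Suc)
  with Cons show ?case
    by (simp add: length_flags del: fact_Suc sum.cl_ivl_Suc)
qed (simp add: length_flags)


section \<open>Cochains of order complexes\<close>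

lemma ex_sorted_chain:
  fixes \<sigma> :: "'a::order set"
  assumes "finite \<sigma>" "Complete_Partial_Order.chain (\<le>) \<sigma>"
  shows "\<exists>xs. sorted_wrt (<) xs \<and> set xs = \<sigma>"
  using assms
proof (induction \<sigma> rule: finite_psubset_induct)
  case (psubset \<sigma>)
  show ?case
  proof (cases "\<sigma> = {}")
    case False
    then obtain m where m: "m \<in> \<sigma>" "\<And>x. x \<in> \<sigma> \<Longrightarrow> m \<le> x \<Longrightarrow> m = x"
      using finite_has_maximal[OF psubset(1)] by metis
    have less: "x < m" if "x \<in> \<sigma>" "x \<noteq> m" for x
      using psubset.prems m that by (metis chainD order_le_less)
    have "Complete_Partial_Order.chain (\<le>) (\<sigma> - {m})"
      using psubset.prems by (rule chain_subset) auto
    then obtain xs where xs: "sorted_wrt (<) xs" "set xs = \<sigma> - {m}"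
      using psubset.IH[of "\<sigma> - {m}"] m by auto
    have "sorted_wrt (<) (xs @ [m])" "set (xs @ [m]) = \<sigma>"
      using xs m less by (auto simp: sorted_wrt_append)
    then show ?thesis by blast
  qed auto
qed

lemma strict_sorted_distinct: "sorted_wrt (<) xs \<Longrightarrow> distinct xs"
  for xs :: "'a::order list"
  by (induction xs) auto

lemma strict_sorted_unique:
  fixes xs :: "'a::order list"
  assumes "sorted_wrt (<) xs" "sorted_wrt (<) ys" "set xs = set ys"
  shows "xs = ys"
  using assms
proof (induction xs arbitrary: ys)
  case (Cons x xs)
  then obtain y zs where ys: "ys = y # zs" by (cases ys) auto
  have "x = y"
    using Cons.prems ys by (metis list.set_intros(1) order_less_asym set_ConsD sorted_wrt.simps(2))
  moreover have "x \<notin> set xs" "y \<notin> set zs"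
    using Cons.prems ys by auto
  ultimately have "set xs = set zs"
    using Cons.prems(3) ys by auto
  then show ?case
    using Cons ys \<open>x = y\<close> by auto
qed simp

text \<open>Cochains live on sets but the homotopy on lists; on finite chains the choice is forced
  by \<open>strict_sorted_unique\<close>.\<close>

definition chain_list :: "'a::order set \<Rightarrow> 'a list" where
  "chain_list \<sigma> = (SOME xs. sorted_wrt (<) xs \<and> set xs = \<sigma>)"

lemma chain_list_set: "sorted_wrt (<) xs \<Longrightarrow> chain_list (set xs) = xs"
  unfolding chain_list_def by (rule some_equality) (auto intro: strict_sorted_unique)

lemma chain_list:
  assumes "\<sigma> \<in> order_complex P"
  shows "sorted_wrt (<) (chain_list \<sigma>)" "set (chain_list \<sigma>) = \<sigma>"
proof -
  obtain xs where "sorted_wrt (<) xs" "set xs = \<sigma>"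
    using assms ex_sorted_chain by (auto simp: order_complex_def)
  then show "sorted_wrt (<) (chain_list \<sigma>)" "set (chain_list \<sigma>) = \<sigma>"
    using chain_list_set[of xs] by auto
qed

lemma set_in_order_complex:
  "sorted_wrt (\<le>) xs \<Longrightarrow> set xs \<subseteq> P \<Longrightarrow> set xs \<in> order_complex P"
proof -
  assume *: "sorted_wrt (\<le>) xs" "set xs \<subseteq> P"
  have "Complete_Partial_Order.chain (\<le>) (set xs)"
    using *(1) by (induction xs) (auto simp: Complete_Partial_Order.chain_def)
  with * show ?thesis by (simp add: order_complex_def)
qed

lemma order_complex_subset:
  "\<sigma> \<in> order_complex P \<Longrightarrow> \<tau> \<subseteq> \<sigma> \<Longrightarrow> \<tau> \<in> order_complex P"
  by (auto simp: order_complex_def intro: finite_subset chain_subset)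

lemma simplices_Diff:
  assumes "\<tau> \<in> simplices (order_complex P) k" "v \<in> \<tau>"
  shows "\<tau> - {v} \<in> simplices (order_complex P) (k - 1)"
proof -
  have "card \<tau> > 0"
    using assms by (auto simp: simplices_def card_gt_0_iff)
  with assms show ?thesis
    by (auto simp: simplices_def intro: order_complex_subset)
qed

text \<open>On a degenerate list the left side is 0 by convention and the right side by
  cancellation, so the formula applies to every term of a filling.\<close>

lemma list_cochain_coboundary:
  assumes "sorted_wrt (\<le>) xs" "set xs \<subseteq> P" "int (length xs) = k + 2"
  shows "list_cochain (coboundary (order_complex P) k \<phi>) xs =
    (\<Sum>ys\<leftarrow>faces xs. list_cochain \<phi> ys)"
proof (cases "distinct xs")
  case True
  then have "set xs \<in> simplices (order_complex P) (k + 1)"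
    using assms by (simp add: simplices_def set_in_order_complex distinct_card)
  with True show ?thesis
    unfolding sum_faces_list_cochain by (simp add: list_cochain_def coboundary_def)
next
  case False
  then show ?thesis
    unfolding sum_faces_list_cochain by (simp add: list_cochain_def)
qed

text \<open>Dual to \<open>sum_faces_faces\<close>, once \<open>\<tau>\<close> is enumerated as a
  list. It will certify that a cochain with non-zero coboundary is not itself a coboundary.\<close>

lemma coboundary_coboundary:
  "coboundary (order_complex P) k (coboundary (order_complex P) (k - 1) \<psi>) = (\<lambda>_. 0)"
proof
  fix \<tau>
  show "coboundary (order_complex P) k (coboundary (order_complex P) (k - 1) \<psi>) \<tau> = 0"
  proof (cases "\<tau> \<in> simplices (order_complex P) (k + 1)")
    case True
    then obtain xs where xs: "set xs = \<tau>" "distinct xs"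
      using finite_distinct_list by (auto simp: simplices_def)
    have "coboundary (order_complex P) k (coboundary (order_complex P) (k - 1) \<psi>) \<tau> =
        (\<Sum>v\<in>\<tau>. \<Sum>w\<in>\<tau> - {v}. \<psi> (\<tau> - {v} - {w}))"
      using simplices_Diff[OF True] True by (simp add: coboundary_def)
    also have "\<dots> = (\<Sum>ys\<leftarrow>faces xs. \<Sum>w\<in>set ys. \<psi> (set ys - {w}))"
      unfolding xs(1)[symmetric] sum_faces_set[OF xs(2), where g = "\<lambda>S. \<Sum>w\<in>S. \<psi> (S - {w})"] ..
    also have "\<dots> = (\<Sum>ys\<leftarrow>faces xs. \<Sum>zs\<leftarrow>faces ys. \<psi> (set zs))"
      using distinct_face[OF _ xs(2)] by (intro sum_list_eqI) (simp add: sum_faces_set)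
    finally show ?thesis
      by (simp add: sum_faces_faces)
  qed (simp add: coboundary_def)
qed

text \<open>Dualizes \<open>\<partial>T + T\<partial> = id\<close>. That identity is formal;
  \<open>fill\<close> enters to expand the coboundary of \<open>\<phi>\<close> on each term of
  \<open>T\<close> over its faces.\<close>

lemma filling_homotopy:
  fixes P :: "'a::complete_lattice set"
  assumes fill: "\<And>xs t. \<lbrakk>sorted_wrt (<) xs; set xs \<subseteq> P; int (length xs) = k + 1;
      t \<in> set (filling a p [] xs)\<rbrakk> \<Longrightarrow>
      sorted_wrt (\<le>) t \<and> set t \<subseteq> P \<and> length t = Suc (length xs)"
  shows "\<exists>\<psi>\<in>cochains (order_complex P) (k - 1). \<forall>\<sigma>\<in>simplices (order_complex P) k.
    \<phi> \<sigma> + coboundary (order_complex P) (k - 1) \<psi> \<sigma> =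
      (\<Sum>t\<leftarrow>filling a p [] (chain_list \<sigma>). list_cochain (coboundary (order_complex P) k \<phi>) t)"
proof -
  let ?X = "order_complex P"
  let ?T = "\<lambda>xs. \<Sum>t\<leftarrow>filling a p [] xs. list_cochain \<phi> t"
  \<comment> \<open>The dual of \<open>T\<close> applied to \<open>\<phi>\<close>, set to 0 off the
    simplices to make it a cochain.\<close>
  define \<psi> where "\<psi> = (\<lambda>\<sigma>. if \<sigma> \<in> simplices ?X (k - 1) then ?T (chain_list \<sigma>) else 0)"
  have "\<phi> \<sigma> + coboundary ?X (k - 1) \<psi> \<sigma> =
      (\<Sum>t\<leftarrow>filling a p [] (chain_list \<sigma>). list_cochain (coboundary ?X k \<phi>) t)"
    if \<sigma>: "\<sigma> \<in> simplices ?X k" for \<sigma>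
  proof -
    define xs where "xs = chain_list \<sigma>"
    have "\<sigma> \<in> ?X" using \<sigma> by (simp add: simplices_def)
    then have xs: "sorted_wrt (<) xs" "set xs = \<sigma>" "distinct xs" "\<sigma> \<subseteq> P"
      using chain_list[of \<sigma> P] strict_sorted_distinct by (auto simp: xs_def order_complex_def)
    have len: "int (length xs) = k + 1"
      using \<sigma> xs by (auto simp: simplices_def distinct_card[symmetric])
    have "(\<Sum>t\<leftarrow>filling a p [] xs. list_cochain (coboundary ?X k \<phi>) t) =
        (\<Sum>t\<leftarrow>filling a p [] xs. \<Sum>s\<leftarrow>faces t. list_cochain \<phi> s)"
    proof (rule sum_list_eqI)
      fix t assume "t \<in> set (filling a p [] xs)"
      then have "sorted_wrt (\<le>) t \<and> set t \<subseteq> P \<and> length t = Suc (length xs)"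
        using fill xs len by blast
      then show "list_cochain (coboundary ?X k \<phi>) t = (\<Sum>s\<leftarrow>faces t. list_cochain \<phi> s)"
        using len by (intro list_cochain_coboundary) auto
    qed
    also have "\<dots> = (\<Sum>ys\<leftarrow>faces xs. ?T ys) + list_cochain \<phi> xs"
      by (simp add: sum_filling_faces)
    also have "(\<Sum>ys\<leftarrow>faces xs. ?T ys) = (\<Sum>ys\<leftarrow>faces xs. ?T (chain_list (set ys)))"
      using sorted_wrt_face[OF _ xs(1)] by (intro sum_list_eqI) (simp add: chain_list_set)
    also have "\<dots> = (\<Sum>v\<in>\<sigma>. ?T (chain_list (\<sigma> - {v})))"
      using sum_faces_set[OF xs(3), of "\<lambda>S. ?T (chain_list S)"] xs(2) by simp
    also have "\<dots> = coboundary ?X (k - 1) \<psi> \<sigma>"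
      using \<sigma> simplices_Diff[OF \<sigma>] by (auto simp: coboundary_def \<psi>_def)
    also have "list_cochain \<phi> xs = \<phi> \<sigma>"
      using xs by (simp add: list_cochain_def)
    finally show ?thesis by (simp add: xs_def add.commute)
  qed
  moreover have "\<psi> \<in> cochains ?X (k - 1)"
    by (auto simp: cochains_def \<psi>_def)
  ultimately show ?thesis by blast
qed

section \<open>Finiteness and the cosystolic norm\<close>

text \<open>A bit-valued function is determined by its support. Finiteness matters because
  \<open>csy_norm\<close> and \<open>cheeger\<close> are defined by \<open>Min\<close>.\<close>

lemma finite_cochains: "finite (A :: ('a::finite set \<Rightarrow> bit) set)"
proof -
  have "inj (\<lambda>\<phi> :: 'a set \<Rightarrow> bit. {\<sigma>. \<phi> \<sigma> \<noteq> 0})"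
  proof (rule injI, rule ext)
    fix \<phi> \<psi> :: "'a set \<Rightarrow> bit" and \<sigma>
    assume "{\<sigma>. \<phi> \<sigma> \<noteq> 0} = {\<sigma>. \<psi> \<sigma> \<noteq> 0}"
    then have "\<phi> \<sigma> \<noteq> 0 \<longleftrightarrow> \<psi> \<sigma> \<noteq> 0" by blast
    then show "\<phi> \<sigma> = \<psi> \<sigma>" by (cases "\<phi> \<sigma>"; cases "\<psi> \<sigma>") auto
  qed
  then have "finite (UNIV :: ('a set \<Rightarrow> bit) set)"
    by (rule inj_on_finite[of _ _ UNIV]) auto
  then show ?thesis by (rule rev_finite_subset) simp
qed

lemma finite_supp_norms:
  fixes F :: "('a::finite set \<Rightarrow> bit) \<Rightarrow> 'b"
  shows "finite {F \<psi> | \<psi>. \<psi> \<in> A}"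
  unfolding setcompr_eq_image by (intro finite_imageI finite_cochains)

lemma csy_norm_le:
  fixes \<phi> :: "'a::finite set \<Rightarrow> bit"
  assumes "\<psi> \<in> cochains X (k - 1)"
  shows "csy_norm X k \<phi> \<le> supp_norm (\<lambda>\<sigma>. \<phi> \<sigma> + coboundary X (k - 1) \<psi> \<sigma>)"
  unfolding csy_norm_def by (rule Min_le[OF finite_supp_norms]) (use assms in blast)

text \<open>The minimum is attained, and a vanishing minimum would make \<open>\<phi>\<close> a
  coboundary. This keeps the denominators in \<open>cheeger\<close> non-zero.\<close>

lemma csy_norm_pos:
  fixes \<phi> :: "'a::finite set \<Rightarrow> bit"
  assumes "\<phi> \<notin> coboundaries X k"
  shows "csy_norm X k \<phi> > 0"
proof -
  have "(\<lambda>_. 0) \<in> cochains X (k - 1)"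
    by (simp add: cochains_def)
  then have "csy_norm X k \<phi> \<in>
      {supp_norm (\<lambda>\<sigma>. \<phi> \<sigma> + coboundary X (k - 1) \<psi> \<sigma>) | \<psi>. \<psi> \<in> cochains X (k - 1)}"
    unfolding csy_norm_def by (intro Min_in[OF finite_supp_norms]) blast
  then obtain \<psi> where \<psi>: "\<psi> \<in> cochains X (k - 1)"
    and eq: "csy_norm X k \<phi> = supp_norm (\<lambda>\<sigma>. \<phi> \<sigma> + coboundary X (k - 1) \<psi> \<sigma>)"
    by blast
  have "\<phi> \<noteq> coboundary X (k - 1) \<psi>"
    using assms \<psi> by (auto simp: coboundaries_def)
  then obtain \<sigma> where "\<phi> \<sigma> \<noteq> coboundary X (k - 1) \<psi> \<sigma>" by auto
  then have "\<phi> \<sigma> + coboundary X (k - 1) \<psi> \<sigma> \<noteq> 0"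
    by (cases "\<phi> \<sigma>"; cases "coboundary X (k - 1) \<psi> \<sigma>") auto
  then show ?thesis
    unfolding eq supp_norm_def by (auto simp: card_gt_0_iff)
qed


section \<open>Automorphisms\<close>

lemma automorphisms_image_proper_part:
  fixes g :: "'a::complete_lattice \<Rightarrow> 'a"
  assumes "g \<in> automorphisms"
  shows "g ` proper_part = proper_part"
proof -
  have g: "bij g" "\<And>x y. g x \<le> g y \<longleftrightarrow> x \<le> y"
    using assms by (auto simp: automorphisms_def)
  have "g (inv g bot) = bot" "g (inv g top) = top"
    using g(1) by (simp_all add: bij_is_surj surj_f_inv_f)
  then have "g bot = bot" "g top = top"
    by (metis bot_least g(2) le_bot, metis g(2) top_greatest top_le)
  then show ?thesis
    using g(1) by (simp add: proper_part_def image_set_diff bij_is_inj bij_is_surj)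
qed

lemma automorphisms_image_simplex:
  fixes g :: "'a::complete_lattice \<Rightarrow> 'a"
  assumes "g \<in> automorphisms" "\<sigma> \<in> simplices (order_complex proper_part) k"
  shows "g ` \<sigma> \<in> simplices (order_complex proper_part) k"
proof -
  have g: "inj g" "\<And>x y. g x \<le> g y \<longleftrightarrow> x \<le> y"
    using assms by (auto simp: automorphisms_def bij_is_inj)
  have "g ` \<sigma> \<subseteq> proper_part"
    using automorphisms_image_proper_part[OF assms(1)] assms(2)
    by (auto simp: simplices_def order_complex_def)
  moreover have "card (g ` \<sigma>) = card \<sigma>"
    using g(1) by (intro card_image) (auto intro: inj_on_subset)
  ultimately show ?thesis
    using assms(2) g(2)
    by (auto simp: simplices_def order_complex_def Complete_Partial_Order.chain_def)
qed

lemma automorphisms_inv: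
  assumes "g \<in> automorphisms"
  shows "inv g \<in> automorphisms"
proof -
  have g: "bij g" "\<And>x y. g x \<le> g y \<longleftrightarrow> x \<le> y"
    using assms by (auto simp: automorphisms_def)
  then have "inv g x \<le> inv g y \<longleftrightarrow> x \<le> y" for x y
    using g(2)[of "inv g x" "inv g y"] by (simp add: bij_is_surj surj_f_inv_f)
  with g(1) show ?thesis
    by (simp add: automorphisms_def bij_imp_bij_inv)
qed

lemma automorphisms_comp:
  "g \<in> automorphisms \<Longrightarrow> h \<in> automorphisms \<Longrightarrow> h \<circ> g \<in> automorphisms"
  by (auto simp: automorphisms_def bij_comp)

lemma automorphisms_image_simplex_iff:
  fixes g :: "'a::complete_lattice \<Rightarrow> 'a"
  assumes "g \<in> automorphisms"
  shows "g ` \<sigma> \<in> simplices (order_complex proper_part) k \<longleftrightarrow>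
    \<sigma> \<in> simplices (order_complex proper_part) k"
proof -
  have "inj g" using assms by (simp add: automorphisms_def bij_is_inj)
  then have "inv g ` g ` \<sigma> = \<sigma>" by (rule image_inv_f_f)
  then show ?thesis
    using assms automorphisms_image_simplex automorphisms_inv by metis
qed

lemma coboundary_image:
  fixes g :: "'a::complete_lattice \<Rightarrow> 'a"
  assumes "g \<in> automorphisms"
  shows "coboundary (order_complex proper_part) k (\<lambda>\<sigma>. \<phi> (g ` \<sigma>)) \<tau> =
    coboundary (order_complex proper_part) k \<phi> (g ` \<tau>)"
proof -
  have inj: "inj g" using assms by (simp add: automorphisms_def bij_is_inj)
  have "(\<Sum>w\<in>g ` \<tau>. \<phi> (g ` \<tau> - {w})) = (\<Sum>v\<in>\<tau>. \<phi> (g ` (\<tau> - {v})))"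
    using inj by (subst sum.reindex) (auto simp: image_set_diff intro: inj_on_subset)
  then show ?thesis
    using automorphisms_image_simplex_iff[OF assms] by (simp add: coboundary_def)
qed

lemma supp_norm_image:
  assumes "bij g"
  shows "supp_norm (\<lambda>\<sigma>. \<phi> (g ` \<sigma>)) = supp_norm \<phi>"
proof -
  have "bij_betw (image g) {\<sigma>. \<phi> (g ` \<sigma>) \<noteq> 0} {\<sigma>. \<phi> \<sigma> \<noteq> 0}"
    using assms by (intro bij_betw_byWitness[of _ "image (inv g)"])
      (auto simp: image_inv_f_f bij_is_inj bij_is_surj image_f_inv_f)
  then show ?thesis
    unfolding supp_norm_def by (rule bij_betw_same_card)
qed

text \<open>A correction \<open>\<psi>\<close> of the translate of \<open>\<phi>\<close> by
  \<open>g\<close> is carried by \<open>inv g\<close> to a correction of \<open>\<phi>\<close>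
  itself, with support of the same size. Hence every translate bounds one and the same norm.\<close>

lemma csy_norm_le_image:
  fixes g :: "'a::{finite,complete_lattice} \<Rightarrow> 'a"
  defines "X \<equiv> order_complex (proper_part :: 'a set)"
  assumes g: "g \<in> automorphisms" and \<psi>: "\<psi> \<in> cochains X (k - 1)"
  shows "csy_norm X k \<phi> \<le> supp_norm (\<lambda>\<sigma>. \<phi> (g ` \<sigma>) + coboundary X (k - 1) \<psi> \<sigma>)"
proof -
  let ?h = "inv g"
  have bij: "bij g" using g by (simp add: automorphisms_def)
  have h: "?h \<in> automorphisms" using g by (rule automorphisms_inv)
  have gh: "g ` ?h ` \<sigma> = \<sigma>" for \<sigma>
    using bij by (simp add: bij_is_surj image_f_inv_f)
  have "(\<lambda>\<sigma>. \<psi> (?h ` \<sigma>)) \<in> cochains X (k - 1)"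
    using \<psi> automorphisms_image_simplex_iff[OF h] unfolding X_def by (auto simp: cochains_def)
  then have "csy_norm X k \<phi> \<le>
      supp_norm (\<lambda>\<sigma>. \<phi> \<sigma> + coboundary X (k - 1) (\<lambda>\<sigma>. \<psi> (?h ` \<sigma>)) \<sigma>)"
    by (rule csy_norm_le)
  also have "\<dots> = supp_norm (\<lambda>\<sigma>. \<phi> (g ` ?h ` \<sigma>) + coboundary X (k - 1) \<psi> (?h ` \<sigma>))"
    unfolding X_def coboundary_image[OF h] gh ..
  also have "\<dots> = supp_norm (\<lambda>\<sigma>. \<phi> (g ` \<sigma>) + coboundary X (k - 1) \<psi> \<sigma>)"
    by (rule supp_norm_image[OF bij_imp_bij_inv[OF bij]])
  finally show ?thesis .
qed

lemma card_automorphisms_image: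
  fixes F :: "'a::{finite,complete_lattice} set set"
  assumes trans: "\<And>\<sigma> \<tau>. \<sigma> \<in> F \<Longrightarrow> \<tau> \<in> F \<Longrightarrow> \<exists>g\<in>automorphisms. g ` \<sigma> = \<tau>"
    and inv: "\<And>g \<sigma>. g \<in> automorphisms \<Longrightarrow> \<sigma> \<in> F \<Longrightarrow> g ` \<sigma> \<in> F"
    and "\<tau> \<in> F" "Z \<subseteq> F"
  shows "card F * card {g \<in> automorphisms. g ` \<tau> \<in> Z} =
    card Z * card (automorphisms :: ('a \<Rightarrow> 'a) set)"
proof -
  let ?A = "automorphisms :: ('a \<Rightarrow> 'a) set"
  let ?N = "\<lambda>\<zeta>. {g \<in> ?A. g ` \<tau> = \<zeta>}"
  have le: "card (?N \<zeta>) \<le> card (?N \<zeta>')" if "\<zeta> \<in> F" "\<zeta>' \<in> F" for \<zeta> \<zeta>'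
  proof -
    from trans[OF that] obtain h where h: "h \<in> ?A" "h ` \<zeta> = \<zeta>'" by blast
    then have "inj h" by (simp add: automorphisms_def bij_is_inj)
    have "inj_on ((\<circ>) h) (?N \<zeta>)"
      using \<open>inj h\<close> by (intro inj_onI) (auto simp: fun_eq_iff dest: injD)
    moreover have "(\<circ>) h ` ?N \<zeta> \<subseteq> ?N \<zeta>'"
      using h automorphisms_comp by (auto simp: image_comp[symmetric])
    ultimately show ?thesis by (intro card_inj_on_le) auto
  qed
  have count: "card {g \<in> ?A. g ` \<tau> \<in> W} = card W * card (?N \<tau>)" if "W \<subseteq> F" for W
  proof -
    have "{g \<in> ?A. g ` \<tau> \<in> W} = (\<Union>\<zeta>\<in>W. ?N \<zeta>)" by auto
    also have "card \<dots> = (\<Sum>\<zeta>\<in>W. card (?N \<zeta>))"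
      by (intro card_UN_disjoint) auto
    also have "\<dots> = (\<Sum>\<zeta>\<in>W. card (?N \<tau>))"
      using that \<open>\<tau> \<in> F\<close> le by (intro sum.cong) (auto intro: antisym)
    finally show ?thesis by simp
  qed
  have "{g \<in> ?A. g ` \<tau> \<in> F} = ?A" using inv \<open>\<tau> \<in> F\<close> by auto
  with count[of F] count[OF \<open>Z \<subseteq> F\<close>] show ?thesis by simp
qed


section \<open>Fillings in geometric lattices\<close>

text \<open>\<open>U\<close> will be the set of atoms and \<open>P\<close> the proper part. The
  invariant that \<open>us\<close> lies below all of \<open>xs\<close> puts the join of
  \<open>us @ [p x]\<close> below \<open>x\<close>, which makes every term of a block a weakly
  increasing list.\<close>

lemma set_filling:
  assumes "t \<in> set (filling a p us xs)"
    and us: "set us \<subseteq> U" "a \<in> U" "\<And>x. x \<in> set xs \<Longrightarrow> p x \<in> U"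
    and below: "\<And>x u. x \<in> set xs \<Longrightarrow> u \<in> set us \<Longrightarrow> u \<le> x" "\<And>x. x \<in> set xs \<Longrightarrow> p x \<le> x"
    and xs: "sorted_wrt (\<le>) xs" "set xs \<subseteq> P"
    and Sup: "\<And>vs. vs \<noteq> [] \<Longrightarrow> set vs \<subseteq> U \<Longrightarrow> length vs \<le> Suc (length us + length xs) \<Longrightarrow>
      Sup (set vs) \<in> P"
  shows "sorted_wrt (\<le>) t \<and> set t \<subseteq> P \<and> length t = Suc (length us + length xs)"
  using assms
proof (induction xs arbitrary: us)
  case Nil
  have t: "t \<in> set (flags (a # us) [])" using Nil(1) by simp
  have "set t \<subseteq> P"
  proof (rule flags_subset[OF t])
    fix vs assume "vs \<noteq> []" "set vs \<subseteq> set (a # us)" "length vs \<le> length (a # us)"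
    then show "Sup (set vs) \<in> P"
      using Nil(2,3) by (intro Nil(9)) auto
  qed simp
  then show ?case
    using flags_sorted[OF t] flags_length[OF t] by simp
next
  case (Cons x xs)
  let ?us = "us @ [p x]"
  from Cons.prems(1) consider "t \<in> set (flags ?us (x # xs))" | "t \<in> set (filling a p ?us xs)"
    by auto
  then show ?case
  proof cases
    case 1
    have "Sup (set ?us) \<le> x"
    proof (rule Sup_least)
      fix u assume "u \<in> set ?us"
      then show "u \<le> x"
        using Cons.prems(5)[of x u] Cons.prems(6)[of x] by auto
    qed
    moreover have "x \<le> y" if "y \<in> set (x # xs)" for y
      using Cons.prems(7) that by auto
    ultimately have "sorted_wrt (\<le>) t"
      using Cons.prems(7) by (intro flags_sorted[OF 1]) (simp_all only: order_trans)
    moreover have "set t \<subseteq> P"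
    proof (rule flags_subset[OF 1])
      fix vs assume "vs \<noteq> []" "set vs \<subseteq> set ?us" "length vs \<le> length ?us"
      then show "Sup (set vs) \<in> P"
        using Cons.prems(2,4) by (intro Cons.prems(9)) auto
    qed (use Cons.prems(8) in simp)
    ultimately show ?thesis
      using flags_length[OF 1] by simp
  next
    case 2
    have "u \<le> y" if "y \<in> set xs" "u \<in> set ?us" for y u
    proof -
      have "x \<le> y" using that(1) Cons.prems(7) by simp
      moreover have "u \<in> set us \<or> u = p x" using that(2) by auto
      ultimately show ?thesis
        using that(1) Cons.prems(5)[of y u] Cons.prems(6)[of x] by auto
    qed
    moreover have "set ?us \<subseteq> U"
      using Cons.prems(2,4) by simp
    moreover have "Sup (set vs) \<in> P"
      if "vs \<noteq> []" "set vs \<subseteq> U" "length vs \<le> Suc (length ?us + length xs)" for vs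
      using that by (intro Cons.prems(9)) auto
    ultimately have "sorted_wrt (\<le>) t \<and> set t \<subseteq> P \<and> length t = Suc (length ?us + length xs)"
      using Cons.prems(3,4,6-8) by (intro Cons.IH[OF 2]) simp_all
    then show ?thesis by simp
  qed
qed

section \<open>Ranks of joins and maximal chains\<close>

lemma ex_cover:
  fixes x :: "'a::{finite,complete_lattice}"
  assumes "x \<noteq> top"
  shows "\<exists>y. covers x y"
proof -
  have "top \<in> {y. x < y}"
    using assms by (simp add: less_top)
  then obtain m where "m \<in> {y. x < y}" "\<And>y. y \<in> {y. x < y} \<Longrightarrow> y \<le> m \<Longrightarrow> m = y"
    using finite_has_minimal[of "{y. x < y}"] by auto
  then show ?thesis
    unfolding covers_def by (metis less_le mem_Collect_eq)
qed

context geometric_lattice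
begin

text \<open>By submodularity each further atom raises the rank by at most one.\<close>

lemma rk_Sup_atoms: "set us \<subseteq> atoms \<Longrightarrow> rk (Sup (set us)) \<le> length us"
  for us :: "'a list"
proof (induction us)
  case (Cons u us)
  have "rk u = 1"
    using Cons.prems rk_covers[of bot u] rk_bot by (simp add: atoms_def)
  moreover have "rk (sup u (Sup (set us))) \<le> rk u + rk (Sup (set us))"
    using rk_submodular[of u "Sup (set us)"] by linarith
  ultimately show ?case
    using Cons by simp
qed (simp add: rk_bot)

lemma ex_atom_le:
  fixes x :: 'a
  assumes "x \<noteq> bot"
  shows "\<exists>u\<in>atoms. u \<le> x"
proof -
  obtain A where "A \<subseteq> atoms" "x = Sup A" using join_of_atoms by blast
  with assms show ?thesis by (cases "A = {}") (auto intro: Sup_upper)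
qed

lemma Sup_atoms_proper:
  fixes us :: "'a list"
  assumes "us \<noteq> []" "set us \<subseteq> atoms" "length us < rk top"
  shows "Sup (set us) \<in> proper_part"
proof -
  have "Sup (set us) \<noteq> top"
    using rk_Sup_atoms[OF assms(2)] assms(3) by auto
  moreover obtain u where "u \<in> set us" "u > bot"
    using assms(1,2) by (cases us) (auto simp: atoms_def covers_def)
  then have "Sup (set us) \<noteq> bot"
    by (metis Sup_upper leD)
  ultimately show ?thesis by (simp add: proper_part_def)
qed

lemma ex_facet:
  assumes "m < rk top"
  shows "\<exists>C y. C \<in> order_complex proper_part \<and> card C = m \<and> rk y = m \<and> (\<forall>c\<in>C. c \<le> y)"
  using assms
proof (induction m)
  case 0
  have "{} \<in> order_complex (proper_part :: 'a set)"
    by (simp add: order_complex_def Complete_Partial_Order.chain_def)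
  with rk_bot show ?case
    by (metis card.empty empty_iff)
next
  case (Suc m)
  then obtain C y where C:
    "C \<in> order_complex proper_part" "card C = m" "rk y = m" "\<And>c. c \<in> C \<Longrightarrow> c \<le> y"
    by auto
  with Suc.prems have "y \<noteq> top" by auto
  then obtain z where "covers y z" using ex_cover by blast
  then have z: "y < z" "rk z = Suc m"
    using rk_covers C(3) by (auto simp: covers_def)
  then have "z \<noteq> top" "z \<noteq> bot" using Suc.prems rk_bot by auto
  moreover have less: "c < z" if "c \<in> C" for c
    using C(4) z(1) that by (meson order_le_less_trans)
  ultimately have "insert z C \<in> order_complex proper_part"
    using C(1)
    by (auto simp: order_complex_def proper_part_def Complete_Partial_Order.chain_def
        intro: less_imp_le)
  moreover have "card (insert z C) = Suc m"
    using less C(2) by (subst card_insert_disjoint) auto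
  ultimately show ?case
    using z less by (metis insert_iff less_imp_le order_refl)
qed

lemma simplices_top_nonempty:
  assumes "rk top \<ge> 1"
  shows "simplices (order_complex (proper_part :: 'a set)) (int (rk top) - 2) \<noteq> {}"
proof -
  obtain C where "C \<in> order_complex (proper_part :: 'a set)" "card C = rk top - 1"
    using ex_facet[of "rk top - 1"] assms by auto
  then have "C \<in> simplices (order_complex proper_part) (int (rk top) - 2)"
    using assms by (simp add: simplices_def of_nat_diff)
  then show ?thesis by blast
qed

text \<open>The lists have \<open>rk top - 2\<close> entries, so with the extra atom
  \<open>a\<close> at most \<open>rk top - 1\<close> atoms are joined and
  \<open>Sup_atoms_proper\<close> applies.\<close>

lemma ex_filling:
  assumes "rk top \<ge> 2"
  shows "\<exists>a p. \<forall>xs t. sorted_wrt (<) xs \<longrightarrow> set xs \<subseteq> (proper_part :: 'a set) \<longrightarrow>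
    int (length xs) = (int (rk top) - 3) + 1 \<longrightarrow> t \<in> set (filling a p [] xs) \<longrightarrow>
    sorted_wrt (\<le>) t \<and> set t \<subseteq> proper_part \<and> length t = Suc (length xs)"
proof -
  have "(top :: 'a) \<noteq> bot"
    using assms rk_bot by auto
  then obtain a :: 'a where a: "a \<in> atoms" using ex_atom_le by blast
  have "\<forall>x\<in>proper_part. \<exists>u\<in>atoms. u \<le> (x :: 'a)"
    using ex_atom_le by (simp add: proper_part_def)
  then obtain p where p: "\<And>x :: 'a. x \<in> proper_part \<Longrightarrow> p x \<in> atoms \<and> p x \<le> x" by metis
  have "sorted_wrt (\<le>) t \<and> set t \<subseteq> proper_part \<and> length t = Suc (length xs)"
    if "sorted_wrt (<) xs" "set xs \<subseteq> proper_part" "int (length xs) = (int (rk top) - 3) + 1"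
      "t \<in> set (filling a p [] xs)" for xs t
  proof -
    have "sorted_wrt (\<le>) xs"
      using that(1) by (rule sorted_wrt_mono_rel[rotated]) auto
    then have "sorted_wrt (\<le>) t \<and> set t \<subseteq> proper_part \<and>
        length t = Suc (length ([] :: 'a list) + length xs)"
      using that p a by (intro set_filling[OF that(4), of atoms]) (auto intro!: Sup_atoms_proper)
    then show ?thesis by simp
  qed
  then show ?thesis by blast
qed

section \<open>Averaging over the automorphism group\<close>

text \<open>Denominators are cleared so that the averaging takes place in
  \<open>nat\<close>.\<close>

lemma csy_norm_bound:
  fixes \<phi> :: "'a set \<Rightarrow> bit" and n :: nat
  defines "X \<equiv> order_complex (proper_part :: 'a set)"
  assumes rk: "rk top = n" "n \<ge> 2" and hom: "homogeneous rk" and \<phi>: "\<phi> \<in> cochains X (int n - 3)"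
  shows "csy_norm X (int n - 3) \<phi> * face_number X (int n - 2) \<le>
    supp_norm (coboundary X (int n - 3) \<phi>) * (face_number X (int n - 3) * (\<Sum>j=1..n-1. fact j))"
proof -
  let ?k = "int n - 3" and ?A = "automorphisms :: ('a \<Rightarrow> 'a) set"
  define F where "F = simplices X (int n - 2)"
  define Z where "Z = {\<tau>. coboundary X ?k \<phi> \<tau> \<noteq> 0}"
  define S :: nat where "S = (\<Sum>j=1..n-1. fact j)"
  obtain a :: 'a and p where fill: "\<And>xs t. \<lbrakk>sorted_wrt (<) xs; set xs \<subseteq> (proper_part :: 'a set);
      int (length xs) = ?k + 1; t \<in> set (filling a p [] xs)\<rbrakk> \<Longrightarrow>
      sorted_wrt (\<le>) t \<and> set t \<subseteq> proper_part \<and> length t = Suc (length xs)"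
    using ex_filling rk by metis
  \<comment> \<open>Intersecting with \<open>F\<close> drops the degenerate terms, whose sets are
    too small. Coinciding terms merge, which is harmless since only an upper bound on
    \<open>card (T \<sigma>)\<close> is wanted.\<close>
  define T where "T = (\<lambda>\<sigma>. set ` set (filling a p [] (chain_list \<sigma>)) \<inter> F)"
  have card_T: "card (T \<sigma>) \<le> S" if "\<sigma> \<in> simplices X ?k" for \<sigma>
  proof -
    have "\<sigma> \<in> X" using that by (simp add: simplices_def)
    then have "length (chain_list \<sigma>) = card \<sigma>"
      using chain_list[of \<sigma> proper_part] unfolding X_def
      by (metis distinct_card strict_sorted_distinct)
    then have len: "length (chain_list \<sigma>) = n - 2"
      using that rk(2) by (auto simp: simplices_def)
    have "card (T \<sigma>) \<le> card (set ` set (filling a p [] (chain_list \<sigma>)))"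
      unfolding T_def by (intro card_mono) auto
    also have "\<dots> \<le> length (filling a p [] (chain_list \<sigma>))"
      using card_image_le card_length order_trans by blast
    also have "\<dots> = S"
    proof -
      have "Suc (length ([] :: 'a list) + (n - 2)) = n - 1" using rk(2) by simp
      then show ?thesis by (simp only: length_filling len S_def) simp
    qed
    finally show ?thesis .
  qed
  have Z: "Z \<subseteq> F"
    by (auto simp: Z_def F_def coboundary_def)
  \<comment> \<open>One translate of \<open>\<phi>\<close> at a time, with \<open>T\<close> the same
    for all \<open>g\<close>: a non-zero value of the corrected cochain at \<open>\<sigma>\<close>
    forces a simplex of \<open>T \<sigma>\<close> that \<open>g\<close> carries into
    \<open>Z\<close>.\<close>
  have le: "csy_norm X ?k \<phi> \<le> (\<Sum>\<sigma>\<in>simplices X ?k. \<Sum>\<tau>\<in>T \<sigma>. of_bool (g ` \<tau> \<in> Z))"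
    if g: "g \<in> ?A" for g
  proof -
    let ?\<phi> = "\<lambda>\<sigma>. \<phi> (g ` \<sigma>)"
    obtain \<psi> where \<psi>: "\<psi> \<in> cochains X (?k - 1)"
      and eq: "\<And>\<sigma>. \<sigma> \<in> simplices X ?k \<Longrightarrow> ?\<phi> \<sigma> + coboundary X (?k - 1) \<psi> \<sigma> =
        (\<Sum>t\<leftarrow>filling a p [] (chain_list \<sigma>). list_cochain (coboundary X ?k ?\<phi>) t)"
      using filling_homotopy[OF fill, where \<phi> = ?\<phi>] unfolding X_def by blast
    have outside: "?\<phi> \<sigma> + coboundary X (?k - 1) \<psi> \<sigma> = 0" if "\<sigma> \<notin> simplices X ?k" for \<sigma>
      using that \<phi> automorphisms_image_simplex_iff[OF g] unfolding X_def
      by (auto simp: cochains_def coboundary_def)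
    have inside: "\<exists>\<tau>\<in>T \<sigma>. g ` \<tau> \<in> Z"
      if \<sigma>: "\<sigma> \<in> simplices X ?k" and nz: "?\<phi> \<sigma> + coboundary X (?k - 1) \<psi> \<sigma> \<noteq> 0" for \<sigma>
    proof -
      have "\<exists>t\<in>set (filling a p [] (chain_list \<sigma>)). list_cochain (coboundary X ?k ?\<phi>) t \<noteq> 0"
      proof (rule ccontr)
        assume "\<not> ?thesis"
        then have "(\<Sum>t\<leftarrow>filling a p [] (chain_list \<sigma>). list_cochain (coboundary X ?k ?\<phi>) t) =
            (\<Sum>t\<leftarrow>filling a p [] (chain_list \<sigma>). 0)"
          by (intro sum_list_eqI) auto
        with nz eq[OF \<sigma>] show False by simp
      qed
      then obtain t where t: "t \<in> set (filling a p [] (chain_list \<sigma>))"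
        and "coboundary X ?k ?\<phi> (set t) \<noteq> 0"
        by (auto simp: list_cochain_def split: if_splits)
      then have "g ` set t \<in> Z"
        unfolding X_def Z_def using coboundary_image[OF g] by simp
      moreover from this have "set t \<in> F"
        using Z automorphisms_image_simplex_iff[OF g] unfolding F_def X_def by blast
      ultimately show ?thesis
        using t by (auto simp: T_def)
    qed
    have "csy_norm X ?k \<phi> \<le> supp_norm (\<lambda>\<sigma>. ?\<phi> \<sigma> + coboundary X (?k - 1) \<psi> \<sigma>)"
      using csy_norm_le_image[OF g] \<psi> unfolding X_def by blast
    also have "\<dots> \<le> card {\<sigma> \<in> simplices X ?k. \<exists>\<tau>\<in>T \<sigma>. g ` \<tau> \<in> Z}"
    proof -
      have "\<sigma> \<in> simplices X ?k \<and> (\<exists>\<tau>\<in>T \<sigma>. g ` \<tau> \<in> Z)"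
        if "?\<phi> \<sigma> + coboundary X (?k - 1) \<psi> \<sigma> \<noteq> 0" for \<sigma>
        using inside[of \<sigma>] outside[of \<sigma>] that by argo
      then show ?thesis
        unfolding supp_norm_def by (intro card_mono finite Collect_mono impI)
    qed
    also have "\<dots> = (\<Sum>\<sigma>\<in>simplices X ?k. of_bool (\<exists>\<tau>\<in>T \<sigma>. g ` \<tau> \<in> Z))"
      by (simp add: sum.If_cases of_bool_def Int_def)
    also have "\<dots> \<le> (\<Sum>\<sigma>\<in>simplices X ?k. \<Sum>\<tau>\<in>T \<sigma>. of_bool (g ` \<tau> \<in> Z))"
    proof (rule sum_mono)
      fix \<sigma>
      show "of_bool (\<exists>\<tau>\<in>T \<sigma>. g ` \<tau> \<in> Z) \<le> (\<Sum>\<tau>\<in>T \<sigma>. of_bool (g ` \<tau> \<in> Z) :: nat)"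
      proof (cases "\<exists>\<tau>\<in>T \<sigma>. g ` \<tau> \<in> Z")
        case True
        then obtain \<tau> where "\<tau> \<in> T \<sigma>" "g ` \<tau> \<in> Z" by blast
        then show ?thesis
          using member_le_sum[of \<tau> "T \<sigma>" "\<lambda>\<tau>. of_bool (g ` \<tau> \<in> Z) :: nat"] by auto
      qed simp
    qed
    finally show ?thesis .
  qed
  have trans: "\<exists>g\<in>?A. g ` \<sigma> = \<tau>" if "\<sigma> \<in> F" "\<tau> \<in> F" for \<sigma> \<tau>
    using hom that rk(1) unfolding homogeneous_def F_def X_def by (auto simp: Let_def)
  have inv: "g ` \<sigma> \<in> F" if "g \<in> ?A" "\<sigma> \<in> F" for g \<sigma>
    using automorphisms_image_simplex that unfolding F_def X_def by blast
  \<comment> \<open>Summing \<open>le\<close> over all automorphisms and exchanging sums reduces the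
    bound to counting, for each \<open>\<tau>\<close>, the automorphisms that carry it into
    \<open>Z\<close>.\<close>
  have "card ?A * (csy_norm X ?k \<phi> * card F) = (\<Sum>g\<in>?A. csy_norm X ?k \<phi>) * card F"
    by simp
  also have "\<dots> \<le> (\<Sum>g\<in>?A. \<Sum>\<sigma>\<in>simplices X ?k. \<Sum>\<tau>\<in>T \<sigma>. of_bool (g ` \<tau> \<in> Z)) * card F"
    using le by (intro mult_right_mono sum_mono) auto
  also have "\<dots> = (\<Sum>\<sigma>\<in>simplices X ?k. \<Sum>\<tau>\<in>T \<sigma>. \<Sum>g\<in>?A. of_bool (g ` \<tau> \<in> Z)) * card F"
  proof -
    have "(\<Sum>g\<in>?A. \<Sum>\<tau>\<in>T \<sigma>. of_bool (g ` \<tau> \<in> Z)) =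
        (\<Sum>\<tau>\<in>T \<sigma>. \<Sum>g\<in>?A. of_bool (g ` \<tau> \<in> Z) :: nat)" for \<sigma>
      by (rule sum.swap)
    then show ?thesis by (subst sum.swap) simp
  qed
  also have "\<dots> = (\<Sum>\<sigma>\<in>simplices X ?k. \<Sum>\<tau>\<in>T \<sigma>. card F * card {g \<in> ?A. g ` \<tau> \<in> Z})"
    by (simp add: sum_distrib_left mult.commute of_bool_def sum.If_cases Int_def)
  \<comment> \<open>Homogeneity enters here: the automorphisms carrying \<open>\<tau>\<close> into
    \<open>Z\<close> are the fraction \<open>card Z / card F\<close> of all.\<close>
  also have "\<dots> = (\<Sum>\<sigma>\<in>simplices X ?k. \<Sum>\<tau>\<in>T \<sigma>. card Z * card ?A)"
    using card_automorphisms_image[OF trans inv _ Z] by (intro sum.cong) (auto simp: T_def)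
  also have "\<dots> = (\<Sum>\<sigma>\<in>simplices X ?k. card (T \<sigma>)) * (card Z * card ?A)"
    by (simp add: sum_distrib_right)
  also have "\<dots> \<le> (\<Sum>\<sigma>\<in>simplices X ?k. S) * (card Z * card ?A)"
    using card_T by (intro mult_right_mono sum_mono) auto
  also have "\<dots> = card ?A * (card Z * (card (simplices X ?k) * S))"
    by simp
  finally have "card ?A * (csy_norm X ?k \<phi> * card F) \<le>
      card ?A * (card Z * (card (simplices X ?k) * S))" .
  moreover have "id \<in> ?A" by (simp add: automorphisms_def)
  then have "card ?A > 0" by (auto simp: card_gt_0_iff)
  ultimately have "csy_norm X ?k \<phi> * card F \<le> card Z * (card (simplices X ?k) * S)"
    by simp
  then show ?thesis
    by (simp add: face_number_def supp_norm_def F_def Z_def S_def)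
qed

section \<open>The Cheeger constant\<close>

text \<open>Ensures that the \<open>Min\<close> in \<open>cheeger\<close> ranges over a non-empty
  set. The indicator of a codimension-one face of a top simplex \<open>\<tau>\<close> works: only
  one deletion from \<open>\<tau>\<close> gives that face, so its coboundary is 1 at
  \<open>\<tau>\<close>.\<close>

lemma ex_noncoboundary:
  fixes n :: nat
  defines "X \<equiv> order_complex (proper_part :: 'a set)"
  assumes "rk top = n" "n \<ge> 2"
  shows "\<exists>\<phi>. \<phi> \<in> cochains X (int n - 3) - coboundaries X (int n - 3)"
proof -
  let ?k = "int n - 3"
  obtain \<tau> where \<tau>: "\<tau> \<in> simplices X (?k + 1)"
    using simplices_top_nonempty assms by fastforce
  then have "\<tau> \<noteq> {}" "finite \<tau>"
    using assms by (auto simp: simplices_def)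
  then obtain v where v: "v \<in> \<tau>" by blast
  define \<phi> :: "'a set \<Rightarrow> bit" where "\<phi> = (\<lambda>\<sigma>. if \<sigma> = \<tau> - {v} then 1 else 0)"
  have "\<phi> \<in> cochains X ?k"
    using simplices_Diff[of \<tau> proper_part "?k + 1" v] \<tau> v by (auto simp: cochains_def \<phi>_def X_def)
  moreover have "\<tau> - {w} = \<tau> - {v} \<longleftrightarrow> w = v" if "w \<in> \<tau>" for w
    using that v by blast
  then have "coboundary X ?k \<phi> \<tau> = (\<Sum>w\<in>\<tau>. if w = v then 1 else 0)"
    using \<tau> by (simp add: coboundary_def \<phi>_def cong: sum.cong)
  then have nz: "coboundary X ?k \<phi> \<noteq> (\<lambda>_. 0)"
    using \<open>finite \<tau>\<close> v by auto
  have "\<phi> \<notin> coboundaries X ?k"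
  proof
    assume "\<phi> \<in> coboundaries X ?k"
    then obtain \<psi> where "\<phi> = coboundary X (?k - 1) \<psi>"
      by (auto simp: coboundaries_def)
    then have "coboundary X ?k \<phi> = (\<lambda>_. 0)"
      unfolding X_def by (simp only: coboundary_coboundary)
    with nz show False by contradiction
  qed
  ultimately show ?thesis by blast
qed

end

theorem theorem3p8:
  fixes rk :: "'a::{finite,complete_lattice} \<Rightarrow> nat" and n :: nat
  assumes "geometric_lattice rk"
    and "rk top = n"
    and "n \<ge> 2"
    and "homogeneous rk"
  shows "cheeger (order_complex (proper_part :: 'a set)) (int n - 3) \<ge>
    real (face_number (order_complex (proper_part :: 'a set)) (int n - 2)) /
      (real (face_number (order_complex (proper_part :: 'a set)) (int n - 3)) *
        (\<Sum>j=1..n - 1. fact j))"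
proof -
  interpret geometric_lattice rk by fact
  let ?X = "order_complex (proper_part :: 'a set)" and ?k = "int n - 3"
  let ?S = "(\<Sum>j=1..n - 1. fact j) :: nat"
  have bound: "real (face_number ?X (int n - 2)) / (real (face_number ?X ?k) * real ?S) \<le>
      real (supp_norm (coboundary ?X ?k \<phi>)) / real (csy_norm ?X ?k \<phi>)"
    if "\<phi> \<in> cochains ?X ?k - coboundaries ?X ?k" for \<phi>
  proof -
    have pos: "csy_norm ?X ?k \<phi> > 0"
      using that csy_norm_pos by blast
    have "csy_norm ?X ?k \<phi> * face_number ?X (int n - 2) \<le>
        supp_norm (coboundary ?X ?k \<phi>) * (face_number ?X ?k * ?S)"
      using csy_norm_bound assms that by blast
    then have "real (csy_norm ?X ?k \<phi>) * real (face_number ?X (int n - 2)) \<le>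
        real (supp_norm (coboundary ?X ?k \<phi>)) * (real (face_number ?X ?k) * real ?S)"
      by (metis of_nat_le_iff of_nat_mult)
    moreover define c where "c = real (face_number ?X ?k) * real ?S"
    moreover have "c \<ge> 0" by (simp add: c_def del: of_nat_sum)
    \<comment> \<open>If \<open>c = 0\<close> the left quotient is 0 by the convention for division
      by zero.\<close>
    ultimately show ?thesis
      using pos unfolding c_def[symmetric] by (cases "c = 0") (auto simp: field_simps)
  qed
  \<comment> \<open>The minimum is attained, so it suffices to have \<open>bound\<close> for a
    single minimizing cochain.\<close>
  have "cheeger ?X ?k \<in> {real (supp_norm (coboundary ?X ?k \<phi>)) / real (csy_norm ?X ?k \<phi>) | \<phi>.
      \<phi> \<in> cochains ?X ?k - coboundaries ?X ?k}"
    unfolding cheeger_def using ex_noncoboundary assms(2,3)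
    by (intro Min_in[OF finite_supp_norms]) blast
  then obtain \<phi> where "\<phi> \<in> cochains ?X ?k - coboundaries ?X ?k"
    and "cheeger ?X ?k = real (supp_norm (coboundary ?X ?k \<phi>)) / real (csy_norm ?X ?k \<phi>)"
    by blast
  with bound[of \<phi>] show ?thesis by simp
qed

end
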